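(* Let $G$ be a chordal graph. Then the dominance complex $\mathrm{Dom}(G)$ of $G$ is homotopy equivalent to a sphere of dimension $\mathrm{v}(G)-1$.
   Context: Graphs are finite, undirected and without loops. A graph is chordal if every induced cycle in it has length at most $3$. A subset $D$ of $V=V(G)$ is a dominating set of $G$ if every vertex not in $D$ is adjacent to at least one vertex of $D$. The dominance complex is $\mathrm{Dom}(G)=\{\sigma\subseteq V : V\setminus\sigma \text{ is a dominating set of } G\}$; equivalently, its minimal non-faces are the minimal elements of $\{N[x] : x\in V\}$, where $N[x]$ is the closed neighbourhood of $x$. A vertex cover of $G$ is a set $C\subseteq V$ such that every edge contains a vertex of $C$; $\mathrm{v}(G)$ is the minimum size of a vertex cover. The complex $\{\emptyset\}$ is regarded as $S^{-1}$. *)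

theory Defs
  imports "HOL-Analysis.Analysis"
begin

text \<open>The set \<open>E\<close> of edges consists of two-element subsets of the vertex set \<open>V\<close>, so edges are
  unordered and there are no loops. \<open>V\<close> may be empty.\<close>

definition finite_graph :: "'a set \<Rightarrow> 'a set set \<Rightarrow> bool" where
  "finite_graph V E \<longleftrightarrow> finite V \<and> (\<forall>e\<in>E. e \<subseteq> V \<and> card e = 2)"

text \<open>An induced cycle is given by the list of its vertices in cyclic order; the edges among
  these vertices are exactly those between cyclically consecutive ones.\<close>

definition induced_cycle :: "'a set \<Rightarrow> 'a set set \<Rightarrow> 'a list \<Rightarrow> bool" where
  "induced_cycle V E c \<longleftrightarrow>
     3 \<le> length c \<and> distinct c \<and> set c \<subseteq> V \<and>
     (\<forall>i<length c. \<forall>j<length c.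
        {c ! i, c ! j} \<in> E \<longleftrightarrow> j = Suc i mod length c \<or> i = Suc j mod length c)"

definition chordal :: "'a set \<Rightarrow> 'a set set \<Rightarrow> bool" where
  "chordal V E \<longleftrightarrow> (\<forall>c. induced_cycle V E c \<longrightarrow> length c \<le> 3)"

definition dominating_set :: "'a set \<Rightarrow> 'a set set \<Rightarrow> 'a set \<Rightarrow> bool" where
  "dominating_set V E D \<longleftrightarrow> D \<subseteq> V \<and> (\<forall>v\<in>V - D. \<exists>u\<in>D. {u, v} \<in> E)"

definition dominance_complex :: "'a set \<Rightarrow> 'a set set \<Rightarrow> 'a set set" where
  "dominance_complex V E = {\<sigma>. \<sigma> \<subseteq> V \<and> dominating_set V E (V - \<sigma>)}"

definition vertex_cover :: "'a set \<Rightarrow> 'a set set \<Rightarrow> 'a set \<Rightarrow> bool" where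
  "vertex_cover V E C \<longleftrightarrow> C \<subseteq> V \<and> (\<forall>e\<in>E. \<exists>v\<in>C. v \<in> e)"

text \<open>For a finite graph the minimum exists, since \<open>V\<close> is itself a vertex cover.\<close>

definition vertex_cover_number :: "'a set \<Rightarrow> 'a set set \<Rightarrow> nat" where
  "vertex_cover_number V E = Min (card ` {C. vertex_cover V E C})"

text \<open>The geometric realization of an abstract simplicial complex \<open>K\<close> with finitely many
  (finite) faces: points are given by barycentric coordinates, extended by zero off the vertices
  of \<open>K\<close>. For such \<open>K\<close> the subspace topology inherited from the product topology is the
  usual (Euclidean, equivalently weak) one. If \<open>K = {{}}\<close>, the realization is empty, because no
  point has empty support and coordinate sum 1.\<close>

definition geometric_realization :: "'a set set \<Rightarrow> ('a \<Rightarrow> real) topology" where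
  "geometric_realization K =
     subtopology (powertop_real UNIV)
       {x. (\<forall>v. 0 \<le> x v) \<and> {v. x v \<noteq> 0} \<in> K \<and> (\<Sum>v\<in>{v. x v \<noteq> 0}. x v) = 1}"

text \<open>\<^const>\<open>nsphere\<close> \<open>n\<close> is the sphere of dimension \<open>n\<close>; the sphere of dimension \<open>-1\<close>, being
  the complex \<open>{{}}\<close>, is the empty space. Dimensions below \<open>-1\<close> are not meaningful.\<close>

definition sphere_of_dim :: "int \<Rightarrow> (nat \<Rightarrow> real) topology" where
  "sphere_of_dim d = (if d < 0 then discrete_topology {} else nsphere (nat d))"

end

theory Submission
  imports Defs
begin

text \<open>The faces of the dominance complex are the vertex sets that contain no closed neighbourhood
  \<open>N[x]\<close>. By Dirac's theorem a nonempty chordal graph \<open>G\<close> has a simplicial vertex \<open>v\<close>, that is, one for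
  which \<open>N[v]\<close> is a clique (\<open>chordal_simplicial_vertex\<close>). Then \<open>N[v] \<subseteq> N[x]\<close> for all \<open>x \<in> N[v]\<close>, and the only
  minimal non-face containing \<open>v\<close> is \<open>N[v]\<close>. Matching faces by inserting and deleting \<open>v\<close> collapses
  the complex \<open>Dom(G)\<close> onto the join of the boundary of the simplex on \<open>N[v]\<close> with \<open>Dom(G - N[v])\<close>
  (\<open>split_off_simplicial_neighbourhood\<close>). That such a matching induces a homotopy equivalence of
  realizations is shown by an explicit deformation retraction
  (\<open>homotopy_equivalent_space_matched_subcomplex\<close>).

  As \<open>G - N[v]\<close> is again chordal, iteration yields a partition \<open>P\<close> of \<open>V\<close> into cliques such that
  \<open>Dom(G)\<close> is homotopy equivalent to the join of the boundaries of the simplices on the blocks. This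
  join is a sphere of dimension \<open>card V - card P - 1\<close> (\<open>homeomorphic_join_of_simplex_boundaries\<close>). The
  simplicial vertices chosen along the way are pairwise non-adjacent, one in each block. Hence they
  form a largest independent set, and its complement is a smallest vertex cover, of size
  \<open>card V - card P\<close> (\<open>vertex_cover_number_eq\<close>).\<close>

section \<open>Simplicial vertices of chordal graphs\<close>

text \<open>Throughout, \<open>E\<close> is kept and only \<open>V\<close> shrinks: the edges of an induced subgraph are those members of
  \<open>E\<close> whose ends are in the smaller \<open>V\<close>. So \<open>E\<close> may have edges that leave \<open>V\<close>.\<close>

definition closed_nbhd :: "'a set set \<Rightarrow> 'a set \<Rightarrow> 'a \<Rightarrow> 'a set" where
  "closed_nbhd E V x = {u \<in> V. u = x \<or> {u, x} \<in> E}"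

definition clique :: "'a set set \<Rightarrow> 'a set \<Rightarrow> bool" where
  "clique E A \<longleftrightarrow> (\<forall>a\<in>A. \<forall>b\<in>A. a \<noteq> b \<longrightarrow> {a, b} \<in> E)"

lemma chordal_subset: "chordal V E \<Longrightarrow> W \<subseteq> V \<Longrightarrow> chordal W E"
  unfolding chordal_def induced_cycle_def by blast

text \<open>A walk of minimal length among those with the same ends inside \<open>A\<close> is an induced path: a repeated
  vertex or a chord would allow a shortcut.\<close>

lemma shortest_walk:
  assumes "successively R p" "p \<noteq> []" "set p \<subseteq> A"
  obtains q where "successively R q" "q \<noteq> []" "hd q = hd p" "last q = last p" "set q \<subseteq> A"
    and "distinct q" and "\<And>i j. i < j \<Longrightarrow> j < length q \<Longrightarrow> R (q ! i) (q ! j) \<Longrightarrow> j = Suc i"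
proof -
  define walk where "walk = (\<lambda>q. successively R q \<and> q \<noteq> [] \<and> hd q = hd p \<and> last q = last p \<and> set q \<subseteq> A)"
  have "walk p" using assms by (simp add: walk_def)
  then obtain q where q: "walk q" and least: "\<And>q'. walk q' \<Longrightarrow> length q \<le> length q'"
    using ex_has_least_nat[of walk p length] by blast
  \<comment> \<open>Cutting out the stretch strictly between positions \<open>i\<close> and \<open>k\<close>. The value \<open>k = length q\<close> is
    admitted, because removing a repetition \<open>q ! i = q ! j\<close> means resuming at \<open>k = Suc j\<close>, and
    \<open>j\<close> may be the last position.\<close>
  have splice: "walk (take (Suc i) q @ drop k q)"
    if "i < k" "k < length q \<Longrightarrow> R (q ! i) (q ! k)" "k \<le> length q" "k = length q \<Longrightarrow> q ! i = last q" for i k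
  proof -
    have i: "i < length q" using that by simp
    have 1: "successively R (take (Suc i) q)" "successively R (drop k q)"
      using q unfolding walk_def by (metis append_take_drop_id successively_append_iff)+
    have ne: "take (Suc i) q \<noteq> []" using i by auto
    have last: "last (take (Suc i) q) = q ! i" using i by (simp add: take_Suc_conv_app_nth)
    have hd: "hd (take (Suc i) q) = hd q" using i by simp
    have "hd (drop k q) = q ! k" if "k < length q" using that by (rule hd_drop_conv_nth)
    then have "successively R (take (Suc i) q @ drop k q)"
      using 1 that last by (cases "k = length q") (auto simp: successively_append_iff)
    moreover have "last (take (Suc i) q @ drop k q) = last q"
      using last that by (cases "k = length q") (auto simp: last_append)
    moreover have "set (take (Suc i) q @ drop k q) \<subseteq> A"
      using q set_take_subset set_drop_subset unfolding walk_def by fastforce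
    ultimately show ?thesis using q ne hd unfolding walk_def by simp
  qed
  have short: "k \<le> Suc i"
    if "i < k" "k < length q \<Longrightarrow> R (q ! i) (q ! k)" "k \<le> length q" "k = length q \<Longrightarrow> q ! i = last q" for i k
    using least[OF splice[OF that]] that(1,3) by simp
  have "q ! i \<noteq> q ! j" if ij: "i < j" "j < length q" for i j
  proof
    assume eq: "q ! i = q ! j"
    have "Suc j \<le> Suc i"
    proof (rule short)
      show "R (q ! i) (q ! Suc j)" if "Suc j < length q"
        using q that eq unfolding walk_def by (simp add: successively_conv_nth)
      show "q ! i = last q" if "Suc j = length q"
        using eq that by (metis diff_Suc_1 last_conv_nth list.size(3) nat.distinct(1))
    qed (use ij in auto)
    then show False using ij by simp
  qed
  then have "distinct q" by (metis distinct_conv_nth nat_neq_iff)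
  moreover have "j = Suc i" if "i < j" "j < length q" "R (q ! i) (q ! j)" for i j
    using short[of i j] that by fastforce
  ultimately show thesis by (intro that[of q]) (use q in \<open>auto simp: walk_def\<close>)
qed

lemma walk_of_rtranclp:
  assumes "R\<^sup>*\<^sup>* a b"
  obtains p where "successively R p" "p \<noteq> []" "hd p = a" "last p = b"
proof -
  have "\<exists>p. successively R p \<and> p \<noteq> [] \<and> hd p = a \<and> last p = b"
    using assms
  proof (induction rule: rtranclp_induct)
    case base
    show ?case by (intro exI[of _ "[a]"]) simp
  next
    case (step b c)
    then obtain p where "successively R p" "p \<noteq> []" "hd p = a" "last p = b" by blast
    then show ?case using step(2) by (intro exI[of _ "p @ [c]"]) (simp add: successively_append_iff)
  qed
  then show thesis using that by blast
qed

lemma induced_cycle_Cons: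
  assumes loopless: "\<And>a. {a} \<notin> E"
    and q: "successively (\<lambda>a b. {a, b} \<in> E) q" "distinct q" "3 \<le> length q"
    and chordless: "\<And>i j. i < j \<Longrightarrow> j < length q \<Longrightarrow> {q ! i, q ! j} \<in> E \<Longrightarrow> j = Suc i"
    and v: "v \<notin> set q" "insert v (set q) \<subseteq> V"
    and ends: "\<And>i. i < length q \<Longrightarrow> {v, q ! i} \<in> E \<longleftrightarrow> i = 0 \<or> Suc i = length q"
  shows "induced_cycle V E (v # q)"
proof -
  let ?n = "length (v # q)"
  have edge: "{(v # q) ! i, (v # q) ! j} \<in> E \<longleftrightarrow> j = Suc i \<or> (i = 0 \<and> Suc j = ?n)"
    if "i < j" "j < ?n" for i j
  proof -
    have "0 < j" using that by simp
    then obtain j' where j': "j = Suc j'" by (cases j) auto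
    show ?thesis
    proof (cases i)
      case 0
      then show ?thesis using ends[of j'] that j' by auto
    next
      case (Suc i')
      then have "{q ! i', q ! j'} \<in> E \<longleftrightarrow> j' = Suc i'"
        using chordless[of i' j'] q(1) that j' by (auto simp: successively_conv_nth)
      then show ?thesis using Suc j' by simp
    qed
  qed
  have cyc: "j = Suc i mod ?n \<or> i = Suc j mod ?n \<longleftrightarrow> j = Suc i \<or> (i = 0 \<and> Suc j = ?n)"
    if "i < j" "j < ?n" for i j
    using that by (cases "Suc j = ?n") auto
  have "{(v # q) ! i, (v # q) ! j} \<in> E \<longleftrightarrow> j = Suc i mod ?n \<or> i = Suc j mod ?n"
    if "i < ?n" "j < ?n" for i j
  proof (rule linorder_cases[of i j])
    assume "i < j"
    then show ?thesis using edge cyc that by blast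
  next
    assume "j < i"
    then show ?thesis using edge[of j i] cyc[of j i] that by (metis insert_commute)
  next
    assume "i = j"
    moreover have "i \<noteq> Suc i mod ?n" using that q(3) by (cases "Suc i = ?n") auto
    ultimately show ?thesis using loopless by simp
  qed
  then show ?thesis using q v by (auto simp: induced_cycle_def)
qed

text \<open>Dirac's theorem, in a form strong enough for induction. For a component \<open>C\<close> of \<open>V - N[v]\<close>, the set
  \<open>S\<close> of its neighbours outside \<open>C\<close> lies in \<open>N[v] - {v}\<close>. It is a clique: a shortest path through \<open>C\<close>
  between two non-adjacent members of \<open>S\<close>, closed up by \<open>v\<close>, would be an induced cycle of length at
  least 4. The graph on \<open>C \<union> S\<close> is smaller, as it misses \<open>v\<close>, and a vertex of \<open>C\<close> has the same
  neighbourhood in it as in \<open>V\<close>; so a simplicial vertex of \<open>C \<union> S\<close> is wanted that avoids \<open>S\<close>. The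
  induction hypothesis supplies one outside the closed neighbourhood of any vertex that does not
  see all of \<open>C \<union> S\<close>; if there is none, \<open>C \<union> S\<close> is a clique and any vertex of \<open>C\<close> will do.\<close>

lemma chordal_simplicial_vertex_outside:
  assumes "finite V" and "\<And>a. {a} \<notin> E" and "chordal V E"
    and "v \<in> V" and "closed_nbhd E V v \<noteq> V"
  shows "\<exists>u\<in>V - closed_nbhd E V v. clique E (closed_nbhd E V u)"
  using assms
proof (induction V arbitrary: v rule: finite_psubset_induct)
  case (psubset V)
  note loopless = psubset.prems(1) and vV = psubset.prems(3)
  let ?N = "closed_nbhd E V v"
  obtain c0 where c0: "c0 \<in> V" "c0 \<notin> ?N"
    using psubset.prems by (auto simp: closed_nbhd_def)
  define R where "R = (\<lambda>a b. a \<in> V - ?N \<and> b \<in> V - ?N \<and> {a, b} \<in> E)"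
  define C where "C = {c. R\<^sup>*\<^sup>* c0 c}"
  define S where "S = {s \<in> ?N. \<exists>c\<in>C. {s, c} \<in> E}"
  have C_sub: "C \<subseteq> V - ?N"
    unfolding C_def using c0 by (auto elim: rtranclp.cases simp: R_def)
  have C_step: "d \<in> C" if "c \<in> C" "R c d" for c d
    using that by (auto simp: C_def)
  have symR: "symp R" by (auto simp: R_def symp_def insert_commute)
  have nbhd_C: "closed_nbhd E V c \<subseteq> C \<union> S" if "c \<in> C" for c
  proof
    fix u
    assume u: "u \<in> closed_nbhd E V c"
    show "u \<in> C \<union> S"
    proof (cases "u \<in> ?N \<or> u = c")
      case True
      then show ?thesis using u that by (auto simp: S_def closed_nbhd_def)
    next
      case False
      then have "R c u" using u that C_sub by (auto simp: R_def closed_nbhd_def insert_commute)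
      then show ?thesis using C_step that by blast
    qed
  qed
  have "v \<notin> S" using C_sub vV by (auto simp: S_def closed_nbhd_def insert_commute)
  have S_adj: "{v, s} \<in> E" if "s \<in> S" for s
    using that \<open>v \<notin> S\<close> by (auto simp: S_def closed_nbhd_def insert_commute)
  have cliqueS: "clique E S"
    unfolding clique_def
  proof (intro ballI impI, rule ccontr)
    fix s t
    assume st: "s \<in> S" "t \<in> S" "s \<noteq> t" "{s, t} \<notin> E"
    obtain a b where ab: "a \<in> C" "b \<in> C" "{s, a} \<in> E" "{t, b} \<in> E"
      using st by (auto simp: S_def)
    have "R\<^sup>*\<^sup>* a b"
      using ab symp_rtranclp[OF symR] unfolding C_def by (metis mem_Collect_eq rtranclp_trans sympE)
    then obtain p where p: "successively R p" "p \<noteq> []" "hd p = a" "last p = b"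
      by (rule walk_of_rtranclp)
    have "set p \<subseteq> C"
    proof -
      have "p ! i \<in> C" if "i < length p" for i
        using that
      proof (induction i)
        case 0
        then show ?case using p ab by (simp add: hd_conv_nth)
      next
        case (Suc i)
        then show ?case using C_step p(1) by (auto simp: successively_conv_nth)
      qed
      then show ?thesis by (auto simp: in_set_conv_nth)
    qed
    let ?adj = "\<lambda>a b. {a, b} \<in> E"
    have "successively ?adj p" using p(1) by (rule successively_mono) (auto simp: R_def)
    then have walk: "successively ?adj (s # p @ [t])"
      using p ab by (auto simp: successively_append_iff successively_Cons insert_commute)
    have sub: "set (s # p @ [t]) \<subseteq> C \<union> {s, t}" using \<open>set p \<subseteq> C\<close> by auto
    obtain q where q: "successively ?adj q" "q \<noteq> []" "hd q = hd (s # p @ [t])"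
      "last q = last (s # p @ [t])" "set q \<subseteq> C \<union> {s, t}" "distinct q"
      and chordless: "\<And>i j. i < j \<Longrightarrow> j < length q \<Longrightarrow> {q ! i, q ! j} \<in> E \<Longrightarrow> j = Suc i"
      by (rule shortest_walk[OF walk list.distinct(2) sub]) blast
    have hd: "q ! 0 = s" and last: "q ! (length q - 1) = t"
      using q by (simp_all add: hd_conv_nth last_conv_nth)
    have "length q \<noteq> 1" using hd last st by auto
    moreover have "length q \<noteq> 2"
      using hd last st q(1) by (auto simp: successively_conv_nth)
    moreover have "length q \<noteq> 0" using q by simp
    ultimately have len: "3 \<le> length q" by linarith
    have "induced_cycle V E (v # q)"
    proof (rule induced_cycle_Cons[OF loopless q(1) q(6) len chordless])
      show "v \<notin> set q" using q(5) C_sub st \<open>v \<notin> S\<close> vV by (auto simp: closed_nbhd_def)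
      show "insert v (set q) \<subseteq> V" using q(5) C_sub st vV by (auto simp: S_def closed_nbhd_def)
      fix i
      assume i: "i < length q"
      show "{v, q ! i} \<in> E \<longleftrightarrow> i = 0 \<or> Suc i = length q"
      proof
        assume "i = 0 \<or> Suc i = length q"
        then have "q ! i = s \<or> q ! i = t" using hd last by (metis diff_Suc_1)
        then show "{v, q ! i} \<in> E" using S_adj st by auto
      next
        assume "{v, q ! i} \<in> E"
        then have "{q ! i, v} \<in> E" by (simp add: insert_commute)
        then have "q ! i \<notin> C" using C_sub by (auto simp: closed_nbhd_def)
        moreover have "q ! i \<in> C \<union> {s, t}" using q(5) i nth_mem by blast
        ultimately have "q ! i = s \<or> q ! i = t" by blast
        then have "q ! i = q ! 0 \<or> q ! i = q ! (length q - 1)" using hd last by simp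
        then have "i = 0 \<or> i = length q - 1"
          using i q(6) by (metis diff_less len less_le_trans nth_eq_iff_index_eq zero_less_numeral zero_less_one)
        then show "i = 0 \<or> Suc i = length q" using i by auto
      qed
    qed
    then have "length (v # q) \<le> 3" using psubset.prems(2) unfolding chordal_def by blast
    then show False using len by simp
  qed
  define H where "H = C \<union> S"
  have c0C: "c0 \<in> C" by (simp add: C_def)
  have HV: "H \<subseteq> V" using C_sub by (auto simp: H_def S_def closed_nbhd_def)
  have "v \<notin> H" using \<open>v \<notin> S\<close> C_sub vV by (auto simp: H_def closed_nbhd_def)
  then have "H \<subset> V" using HV vV by auto
  have chordalH: "chordal H E" using chordal_subset psubset.prems(2) HV by blast
  have IH: "\<exists>u\<in>H - closed_nbhd E H w. clique E (closed_nbhd E H u)"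
    if "w \<in> H" "closed_nbhd E H w \<noteq> H" for w
    using psubset.IH[OF \<open>H \<subset> V\<close> loopless chordalH that] .
  \<comment> \<open>A non-dominating vertex of \<open>S\<close> is preferred as the base point: all of \<open>S\<close> lies in its
    neighbourhood. If \<open>S\<close> has none, then every vertex of \<open>S\<close> sees the chosen \<open>w\<close>.\<close>
  have "\<exists>u\<in>C. clique E (closed_nbhd E H u)"
  proof (cases "\<forall>s\<in>S. closed_nbhd E H s = H")
    case False
    then obtain s where s: "s \<in> S" "closed_nbhd E H s \<noteq> H" by blast
    then obtain u where u: "u \<in> H - closed_nbhd E H s" "clique E (closed_nbhd E H u)"
      using IH[of s] by (auto simp: H_def)
    have "S \<subseteq> closed_nbhd E H s" using cliqueS s by (auto simp: clique_def closed_nbhd_def H_def)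
    then show ?thesis using u by (auto simp: H_def)
  next
    case True
    show ?thesis
    proof (cases "\<forall>w\<in>H. closed_nbhd E H w = H")
      case True
      have "{a, b} \<in> E" if "a \<in> H" "b \<in> H" "a \<noteq> b" for a b
      proof -
        have "a \<in> closed_nbhd E H b" using True that by blast
        then show ?thesis using that by (auto simp: closed_nbhd_def)
      qed
      then have "clique E H" unfolding clique_def by blast
      moreover have "c0 \<in> H" using c0C by (simp add: H_def)
      then have "closed_nbhd E H c0 = H" using True \<open>c0 \<in> H\<close> by blast
      ultimately show ?thesis using c0C by (intro bexI[of _ c0]) simp_all
    next
      case False
      then obtain w where w: "w \<in> H" "closed_nbhd E H w \<noteq> H" by blast
      then obtain u where u: "u \<in> H - closed_nbhd E H w" "clique E (closed_nbhd E H u)"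
        using IH by blast
      have "u \<notin> S"
      proof
        assume "u \<in> S"
        then have "w \<in> closed_nbhd E H u" using True w by blast
        then have "{u, w} \<in> E \<or> u = w" by (auto simp: closed_nbhd_def insert_commute)
        then show False using u(1) by (auto simp: closed_nbhd_def)
      qed
      then show ?thesis using u by (auto simp: H_def)
    qed
  qed
  then obtain u where u: "u \<in> C" "clique E (closed_nbhd E H u)" by blast
  have "closed_nbhd E V u = closed_nbhd E H u"
    using nbhd_C[OF u(1)] HV by (auto simp: H_def closed_nbhd_def)
  then show ?case using u C_sub by (intro bexI[of _ u]) auto
qed

lemma chordal_simplicial_vertex:
  assumes "finite V" and "\<And>a. {a} \<notin> E" and "chordal V E" and "V \<noteq> {}"
  obtains v where "v \<in> V" and "clique E (closed_nbhd E V v)"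
proof (cases "\<forall>v\<in>V. closed_nbhd E V v = V")
  case False
  then show thesis using chordal_simplicial_vertex_outside[OF assms(1-3)] that by blast
next
  case True
  then have "clique E V" unfolding clique_def closed_nbhd_def by blast
  then show thesis using that True assms(4) by (metis ex_in_conv)
qed

section \<open>Collapsing faces matched by one vertex\<close>

definition realization_points :: "'a set set \<Rightarrow> ('a \<Rightarrow> real) set" where
  "realization_points K =
     {x. (\<forall>v. 0 \<le> x v) \<and> {v. x v \<noteq> 0} \<in> K \<and> (\<Sum>v\<in>{v. x v \<noteq> 0}. x v) = 1}"

lemma geometric_realization_eq: "geometric_realization K = top_of_set (realization_points K)"
  by (simp add: geometric_realization_def realization_points_def euclidean_product_topology)

lemma realization_points_iff:
  assumes "finite V" and "K \<subseteq> Pow V"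
  shows "x \<in> realization_points K \<longleftrightarrow> (\<forall>u. 0 \<le> x u) \<and> {u. x u \<noteq> 0} \<in> K \<and> sum x V = 1"
proof (cases "{u. x u \<noteq> 0} \<in> K")
  case True
  then have "{u. x u \<noteq> 0} \<subseteq> V" using assms by auto
  then have "sum x {u. x u \<noteq> 0} = sum x V"
    using assms by (intro sum.mono_neutral_left) auto
  then show ?thesis by (simp add: realization_points_def)
qed (simp add: realization_points_def)

lemma continuous_on_coordinate: "continuous_on S (\<lambda>x::'a \<Rightarrow> real. x u)"
  by (rule continuous_on_product_then_coordinatewise) simp

lemma continuous_on_Min_image:
  fixes f :: "'i \<Rightarrow> 'b::topological_space \<Rightarrow> real"
  assumes "finite I" "I \<noteq> {}" "\<And>i. i \<in> I \<Longrightarrow> continuous_on S (f i)"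
  shows "continuous_on S (\<lambda>x. Min ((\<lambda>i. f i x) ` I))"
  using assms by (induction rule: finite_ne_induct) (auto intro!: continuous_on_min)

lemma continuous_on_Max_image:
  fixes f :: "'i \<Rightarrow> 'b::topological_space \<Rightarrow> real"
  assumes "finite I" "I \<noteq> {}" "\<And>i. i \<in> I \<Longrightarrow> continuous_on S (f i)"
  shows "continuous_on S (\<lambda>x. Max ((\<lambda>i. f i x) ` I))"
  using assms by (induction rule: finite_ne_induct) (auto intro!: continuous_on_max)

text \<open>If the faces outside a subcomplex \<open>K'\<close> are matched by inserting and deleting one fixed vertex
  \<open>v\<close>, then they can be collapsed away, and \<open>K'\<close> is a deformation retract of \<open>K\<close>. The retraction is
  explicit: lower all coordinates other than \<open>v\<close> by the same amount \<open>t x\<close>, cutting off at zero,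
  and give the freed mass to \<open>v\<close>, where \<open>t x\<close> is the least amount after which the coordinates other
  than \<open>v\<close> that survive span a face of \<open>K'\<close>. Since \<open>t\<close> is a minimum of maxima of coordinates it is
  continuous, and the straight line from a point to its image stays in \<open>K\<close>.\<close>

lemma homotopy_equivalent_space_matched_subcomplex:
  assumes fin: "finite V" and KV: "K \<subseteq> Pow V" and "K' \<subseteq> K" and vV: "v \<in> V" and empty: "{} \<in> K'"
    and down: "\<And>\<sigma> \<tau>. \<sigma> \<in> K \<Longrightarrow> \<tau> \<subseteq> \<sigma> \<Longrightarrow> \<tau> \<in> K"
    and down': "\<And>\<sigma> \<tau>. \<sigma> \<in> K' \<Longrightarrow> \<tau> \<subseteq> \<sigma> \<Longrightarrow> \<tau> \<in> K'"
    and matched: "\<And>\<sigma>. \<sigma> \<in> K - K' \<Longrightarrow> insert v \<sigma> \<in> K \<and> \<sigma> - {v} \<notin> K'"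
  shows "geometric_realization K homotopy_equivalent_space geometric_realization K'"
proof -
  define top where "top = (\<lambda>(x::'a \<Rightarrow> real) \<tau>. Max (insert 0 (x ` (V - insert v \<tau>))))"
  define t where "t = (\<lambda>x::'a \<Rightarrow> real. Min (top x ` K'))"
  define r where "r = (\<lambda>(x::'a \<Rightarrow> real) u. if u = v then 1 - (\<Sum>w\<in>V - {v}. max (x w - t x) 0)
     else max (x u - t x) 0)"
  have K'V: "K' \<subseteq> Pow V" using KV \<open>K' \<subseteq> K\<close> by auto
  have finK': "finite K'" using K'V fin by (meson finite_Pow_iff finite_subset)
  note K_iff = realization_points_iff[OF fin KV] and K'_iff = realization_points_iff[OF fin K'V]
  have top_nonneg: "0 \<le> top x \<tau>" for x \<tau> using fin by (simp add: top_def)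
  have t_nonneg: "0 \<le> t x" for x
    unfolding t_def using finK' empty top_nonneg by (subst Min_ge_iff) auto
  have t_zero: "t x = 0" if "{u. x u \<noteq> 0} \<in> K'" for x
  proof -
    have "top x {u. x u \<noteq> 0} \<le> 0"
      unfolding top_def using fin by (subst Max_le_iff) auto
    moreover have "t x \<le> top x {u. x u \<noteq> 0}"
      unfolding t_def using that finK' by (intro Min_le) auto
    ultimately show ?thesis using t_nonneg[of x] by linarith
  qed
  have above: "{u. u \<noteq> v \<and> t x < x u} \<in> K'" if "x \<in> realization_points K" for x
  proof -
    have "t x \<in> top x ` K'" unfolding t_def using finK' empty by (intro Min_in) auto
    then obtain \<tau> where \<tau>: "\<tau> \<in> K'" "t x = top x \<tau>" by auto
    have "x u \<le> t x" if "u \<in> V - insert v \<tau>" for u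
      unfolding \<tau>(2) top_def using that fin by (intro Max_ge) auto
    moreover have "u \<in> V" if "t x < x u" for u
    proof -
      have "x u \<noteq> 0" using that t_nonneg[of x] by linarith
      then show ?thesis using \<open>x \<in> realization_points K\<close> KV by (auto simp: K_iff)
    qed
    ultimately have "{u. u \<noteq> v \<and> t x < x u} \<subseteq> \<tau>" by force
    then show ?thesis using down' \<tau>(1) by blast
  qed
  have r_id: "r x = x" if x: "x \<in> realization_points K'" for x
  proof -
    have "t x = 0" using x t_zero by (simp add: K'_iff)
    moreover have "sum x V = x v + sum x (V - {v})" using fin vV by (simp add: sum.remove)
    ultimately show ?thesis using x by (auto simp: r_def K'_iff fun_eq_iff)
  qed
  \<comment> \<open>For a point \<open>x\<close> outside \<open>K'\<close>, both \<open>x\<close> and its image lie in the face \<open>insert v (supp x)\<close> of \<open>K\<close>;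
    the surviving part of the support belongs to \<open>K'\<close>, and adding \<open>v\<close> to it does not leave \<open>K'\<close>, since
    deleting \<open>v\<close> from a face outside \<open>K'\<close> never leads into \<open>K'\<close>.\<close>
  have r_out: "{u. r x u \<noteq> 0} \<in> K' \<and> insert v {u. x u \<noteq> 0} \<in> K \<and> {u. r x u \<noteq> 0} \<subseteq> insert v {u. x u \<noteq> 0}"
    if x: "x \<in> realization_points K" and out: "{u. x u \<noteq> 0} \<notin> K'" for x
  proof -
    let ?\<sigma> = "{u. u \<noteq> v \<and> t x < x u}"
    have ins: "insert v {u. x u \<noteq> 0} \<in> K" using matched x out by (auto simp: K_iff)
    have sub: "?\<sigma> \<subseteq> {u. x u \<noteq> 0}" using t_nonneg[of x] by auto
    have "insert v ?\<sigma> \<in> K" using down[OF ins] sub by blast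
    moreover have "insert v ?\<sigma> - {v} = ?\<sigma>" by auto
    ultimately have "insert v ?\<sigma> \<in> K'" using matched[of "insert v ?\<sigma>"] above[OF x] by auto
    moreover have "{u. r x u \<noteq> 0} \<subseteq> insert v ?\<sigma>" by (auto simp: r_def)
    ultimately show ?thesis using down' ins sub by (meson insert_mono order.trans)
  qed
  have r_in: "r x \<in> realization_points K'" if x: "x \<in> realization_points K" for x
  proof (cases "{u. x u \<noteq> 0} \<in> K'")
    case True
    then have "x \<in> realization_points K'" using x by (simp add: K_iff K'_iff)
    then show ?thesis using r_id by simp
  next
    case False
    have "(\<Sum>w\<in>V - {v}. max (x w - t x) 0) \<le> sum x (V - {v})"
      using x t_nonneg[of x] by (intro sum_mono) (auto simp: K_iff)
    also have "\<dots> \<le> sum x V"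
      using x fin by (intro sum_mono2) (auto simp: K_iff)
    finally have "0 \<le> r x v" using x by (simp add: r_def K_iff)
    then have "0 \<le> r x u" for u by (cases "u = v") (auto simp: r_def)
    moreover have "sum (r x) V = r x v + sum (r x) (V - {v})" using fin vV by (simp add: sum.remove)
    then have "sum (r x) V = 1" by (simp add: r_def)
    ultimately show ?thesis using r_out[OF x False] by (simp add: K'_iff)
  qed
  have cont_t: "continuous_on S t" for S
    unfolding t_def top_def
  proof (rule continuous_on_Min_image)
    fix \<tau>
    \<comment> \<open>The constant 0 becomes one more member of the family of functions, indexed by \<open>None\<close>.\<close>
    have eq: "Max (insert 0 (x ` (V - insert v \<tau>))) =
       Max ((\<lambda>i. case i of None \<Rightarrow> 0 | Some u \<Rightarrow> x u) ` insert None (Some ` (V - insert v \<tau>)))"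
      for x :: "'a \<Rightarrow> real"
      by (simp add: image_image)
    show "continuous_on S (\<lambda>x. Max (insert 0 (x ` (V - insert v \<tau>))))"
      unfolding eq using fin
    proof (intro continuous_on_Max_image)
      show "continuous_on S (\<lambda>x::'a \<Rightarrow> real. case i of None \<Rightarrow> 0 | Some u \<Rightarrow> x u)" for i
        by (cases i) (auto intro: continuous_on_coordinate)
    qed auto
  qed (use finK' empty in auto)
  have cont_r: "continuous_on S (\<lambda>x. r x u)" for S u
    unfolding r_def by (cases "u = v") (auto intro!: continuous_intros cont_t continuous_on_coordinate)
  have r_map: "continuous_map (geometric_realization K) (geometric_realization K') r"
    unfolding geometric_realization_eq
    using r_in cont_r by (auto intro!: continuous_on_coordinatewise_then_product)
  have id_map: "continuous_map (geometric_realization K') (geometric_realization K) id"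
    unfolding geometric_realization_eq using \<open>K' \<subseteq> K\<close> by (auto simp: K_iff K'_iff)
  define h where "h = (\<lambda>(s::real, x) u. (1 - s) * x u + s * r x u)"
  have "continuous_on ({0..1} \<times> realization_points K) h"
  proof (rule continuous_on_coordinatewise_then_product)
    fix u
    have 1: "continuous_on ({0..1} \<times> realization_points K) (\<lambda>p. snd p u)"
      by (rule continuous_on_compose2[OF continuous_on_coordinate[of UNIV u] continuous_on_snd]) (auto intro: continuous_intros)
    have 2: "continuous_on ({0..1} \<times> realization_points K) (\<lambda>p. r (snd p) u)"
      by (rule continuous_on_compose2[OF cont_r[of UNIV u] continuous_on_snd]) (auto intro: continuous_intros)
    show "continuous_on ({0..1} \<times> realization_points K) (\<lambda>p. h p u)"
      unfolding h_def case_prod_beta by (intro continuous_intros 1 2)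
  qed
  moreover have "h (s, x) \<in> realization_points K" if s: "s \<in> {0..1}" and x: "x \<in> realization_points K" for s x
  proof (cases "{u. x u \<noteq> 0} \<in> K'")
    case True
    then have "r x = x" using x r_id by (simp add: K_iff K'_iff)
    then have "h (s, x) = x" by (simp add: h_def fun_eq_iff algebra_simps)
    then show ?thesis using x by simp
  next
    case False
    have "sum (h (s, x)) V = (1 - s) * sum x V + s * sum (r x) V"
      by (simp add: h_def sum.distrib sum_distrib_left)
    then have "sum (h (s, x)) V = 1" using x r_in[OF x] by (simp add: K_iff K'_iff)
    moreover have "{u. h (s, x) u \<noteq> 0} \<subseteq> insert v {u. x u \<noteq> 0}"
      using r_out[OF x False] by (auto simp: h_def)
    then have "{u. h (s, x) u \<noteq> 0} \<in> K" using r_out[OF x False] down by blast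
    moreover have "0 \<le> h (s, x) u" for u
      using s x r_in[OF x] by (auto simp: h_def K_iff K'_iff)
    ultimately show ?thesis by (simp add: K_iff)
  qed
  ultimately have "homotopic_with (\<lambda>_. True) (geometric_realization K) (geometric_realization K) id r"
    unfolding homotopic_with_def geometric_realization_eq
    by (intro exI[of _ h]) (auto simp: h_def)
  then have "homotopic_with (\<lambda>_. True) (geometric_realization K) (geometric_realization K) (id \<circ> r) id"
    by (simp add: homotopic_with_sym)
  moreover have "homotopic_with (\<lambda>_. True) (geometric_realization K') (geometric_realization K') (r \<circ> id) id"
    using r_id continuous_map_compose[OF id_map r_map]
    by (intro homotopic_with_equal) (auto simp: geometric_realization_eq)
  ultimately show ?thesis
    unfolding homotopy_equivalent_space_def using r_map id_map by blast
qed

section \<open>Joins of boundaries of simplices\<close>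

text \<open>The independence complex of a hypergraph, given by its hyperedges \<open>H\<close>. The minimal non-faces are the
  minimal members of \<open>H\<close> inside \<open>V\<close>, and the union of hypergraphs on disjoint vertex sets corresponds to the
  join of complexes.\<close>

definition independence_complex :: "'a set \<Rightarrow> 'a set set \<Rightarrow> 'a set set" where
  "independence_complex V H = {\<sigma>. \<sigma> \<subseteq> V \<and> (\<forall>h\<in>H. \<not> h \<subseteq> \<sigma>)}"

lemma independence_complex_down:
  "\<sigma> \<in> independence_complex V H \<Longrightarrow> \<tau> \<subseteq> \<sigma> \<Longrightarrow> \<tau> \<in> independence_complex V H"
  unfolding independence_complex_def by blast

text \<open>\<open>B u\<close> is the block of \<open>u\<close> and \<open>\<rho> u\<close> the chosen representative of that block.\<close>

lemma partition_transversal: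
  assumes "partition_on V P"
  obtains \<rho> B where "\<And>u. u \<in> V \<Longrightarrow> B u \<in> P \<and> u \<in> B u \<and> \<rho> u \<in> B u"
    and "\<And>p u. p \<in> P \<Longrightarrow> u \<in> p \<Longrightarrow> B u = p"
    and "\<And>u w. u \<in> V \<Longrightarrow> w \<in> B u \<Longrightarrow> \<rho> w = \<rho> u"
    and "card (\<rho> ` V) = card P"
proof -
  define B where "B = (\<lambda>u. THE p. p \<in> P \<and> u \<in> p)"
  define r where "r = (\<lambda>p. SOME u. u \<in> (p::'a set))"
  have disj: "p = q" if "p \<in> P" "q \<in> P" "u \<in> p" "u \<in> q" for p q u
    using partition_onD2[OF assms] that by (auto simp: disjoint_def)
  have B_eq: "B u = p" if "p \<in> P" "u \<in> p" for p u
    unfolding B_def using that disj by (intro the_equality) auto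
  have B: "B u \<in> P \<and> u \<in> B u" if "u \<in> V" for u
    using that partition_onD1[OF assms] B_eq by auto
  have r: "r p \<in> p" if "p \<in> P" for p
    unfolding r_def using partition_onD3[OF assms] that by (metis ex_in_conv someI)
  have "B ` V = P"
    using B B_eq r partition_onD1[OF assms] by (force simp: image_iff)
  then have "(\<lambda>u. r (B u)) ` V = r ` P" by (metis image_image)
  moreover have "inj_on r P" by (rule inj_onI) (metis disj r)
  ultimately have card: "card ((\<lambda>u. r (B u)) ` V) = card P" by (simp add: card_image)
  have const: "r (B w) = r (B u)" if "u \<in> V" "w \<in> B u" for u w using that B B_eq by metis
  show thesis
    by (rule that[of B "\<lambda>u. r (B u)", OF _ B_eq const card]) (use B r in auto)
qed

text \<open>When the minimal non-faces are the blocks of a partition, the complex is the join of the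
  boundaries of the simplices on the blocks. A point of its realization is a nonnegative vector
  that has minimum 0 on every block, normalised to coordinate sum 1. Vectors with all block minima 0
  represent the classes of arbitrary vectors modulo those constant on each block, and so do the
  vectors that vanish at one representative of every block; the latter form a Euclidean space of
  dimension \<open>card V - card P\<close>. Passing from one kind of representative to the other, and rescaling
  to coordinate sum 1 or to Euclidean norm 1, gives inverse homeomorphisms with the unit sphere.\<close>

lemma homeomorphic_join_of_simplex_boundaries:
  assumes fin: "finite V" and P: "partition_on V P"
  shows "geometric_realization (independence_complex V P)
    homeomorphic_space sphere_of_dim (int (card V) - int (card P) - 1)"
proof -
  let ?K = "independence_complex V P" and ?X = "realization_points (independence_complex V P)"
  obtain \<rho> B where B: "\<And>u. u \<in> V \<Longrightarrow> B u \<in> P \<and> u \<in> B u \<and> \<rho> u \<in> B u"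
    and B_eq: "\<And>p u. p \<in> P \<Longrightarrow> u \<in> p \<Longrightarrow> B u = p"
    and \<rho>_eq: "\<And>u w. u \<in> V \<Longrightarrow> w \<in> B u \<Longrightarrow> \<rho> w = \<rho> u"
    and card_\<rho>: "card (\<rho> ` V) = card P"
    by (rule partition_transversal[OF P]) (rule that)
  have B_sub: "p \<subseteq> V" if "p \<in> P" for p using that partition_onD1[OF P] by auto
  have \<rho>V: "\<rho> u \<in> V" if "u \<in> V" for u using B B_sub that by blast
  have \<rho>\<rho>: "\<rho> (\<rho> u) = \<rho> u" if "u \<in> V" for u using B \<rho>_eq that by blast
  have B_const: "B w = B u" if "u \<in> V" "w \<in> B u" for u w using B B_eq that by blast
  have finB: "finite (B u)" if "u \<in> V" for u
    using that B by (intro finite_subset[OF B_sub fin]) blast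
  have K_sub: "?K \<subseteq> Pow V" by (auto simp: independence_complex_def)
  have supp: "{u. x u \<noteq> 0} \<in> ?K \<longleftrightarrow> (\<forall>u. u \<notin> V \<longrightarrow> x u = 0) \<and> (\<forall>p\<in>P. \<exists>u\<in>p. x u = 0)"
    for x :: "'a \<Rightarrow> real"
    by (auto simp: independence_complex_def)
  note X_iff = realization_points_iff[OF fin K_sub, unfolded supp]
  have zero: "\<exists>w\<in>B u. x w = 0" if "x \<in> ?X" "u \<in> V" for x u
    using that B[of u] by (auto simp: X_iff)
  have outside: "x u = 0" if "x \<in> ?X" "u \<notin> V" for x u
    using that by (auto simp: X_iff)
  have not_const: False if x: "x \<in> ?X" and "\<And>u. u \<in> V - \<rho> ` V \<Longrightarrow> x u = x (\<rho> u)" for x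
  proof -
    have const: "x u = x (\<rho> u)" if "u \<in> V" for u
      using that \<open>\<And>u. u \<in> V - \<rho> ` V \<Longrightarrow> x u = x (\<rho> u)\<close> \<rho>\<rho> by (cases "u \<in> \<rho> ` V") auto
    have "x u = 0" if u: "u \<in> V" for u
    proof -
      obtain w where w: "w \<in> B u" "x w = 0" using zero[OF x u] by blast
      moreover have "w \<in> V" using w B B_sub u by blast
      ultimately show ?thesis using const u \<rho>_eq by metis
    qed
    then show False using x by (simp add: X_iff)
  qed
  define n where "n = card (V - \<rho> ` V)"
  have "card (\<rho> ` V) \<le> card V" using fin by (rule card_image_le)
  then have dim: "int (card V) - int (card P) = int n"
    unfolding n_def using card_\<rho> \<rho>V fin by (subst card_Diff_subset) auto
  show ?thesis
  proof (cases n)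
    case 0
    then have "V - \<rho> ` V = {}" using fin by (simp add: n_def)
    then have "?X = {}" using not_const by blast
    then have "geometric_realization ?K = discrete_topology {}"
      by (simp add: geometric_realization_eq)
    then show ?thesis using dim 0 by (simp add: sphere_of_dim_def homeomorphic_empty_space_eq)
  next
    case (Suc m)
    obtain h where h: "bij_betw h {..m} (V - \<rho> ` V)"
      using ex_bij_betw_nat_finite[of "V - \<rho> ` V"] fin Suc
      by (metis atLeast0LessThan finite_Diff lessThan_Suc_atMost n_def)
    define k where "k = inv_into {..m} h"
    have kh: "k (h i) = i" if "i \<le> m" for i
      unfolding k_def using h that by (simp add: bij_betw_def inv_into_f_f)
    have hk: "h (k u) = u" "k u \<le> m" if "u \<in> V - \<rho> ` V" for u
      unfolding k_def using h that by (metis bij_betw_def f_inv_into_f, metis atMost_iff bij_betw_def inv_into_into)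
    have hV: "h i \<in> V - \<rho> ` V" if "i \<le> m" for i
      using h that by (auto simp: bij_betw_def)
    \<comment> \<open>\<open>D\<close> subtracts on each block the value at the representative, \<open>w\<close> subtracts the block minimum;
      \<open>F\<close> and \<open>G\<close> are these maps followed by normalisation. The bijection \<open>h\<close>, with inverse \<open>k\<close>,
      numbers the vertices that are not representatives.\<close>
    define T where "T = {y::nat \<Rightarrow> real. (\<Sum>i\<le>m. y i ^ 2) = 1 \<and> (\<forall>i>m. y i = 0)}"
    define nrm where "nrm = (\<lambda>y::nat \<Rightarrow> real. sqrt (\<Sum>i\<le>m. y i ^ 2))"
    define D where "D = (\<lambda>(x::'a \<Rightarrow> real) i. if i \<le> m then x (h i) - x (\<rho> (h i)) else 0)"
    define F where "F = (\<lambda>x i. D x i / nrm (D x))"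
    define L where "L = (\<lambda>(y::nat \<Rightarrow> real) u. if u \<in> V - \<rho> ` V then y (k u) else 0)"
    define w where "w = (\<lambda>(y::nat \<Rightarrow> real) u. if u \<in> V then L y u - Min (L y ` B u) else 0)"
    define G where "G = (\<lambda>y u. w y u / sum (w y) V)"
    have sphere: "sphere_of_dim (int (card V) - int (card P) - 1) = top_of_set T"
      using dim Suc by (simp add: sphere_of_dim_def nsphere T_def euclidean_product_topology)
    have nrm_nonneg: "0 \<le> nrm y" for y by (simp add: nrm_def sum_nonneg)
    have nrm_div: "nrm (\<lambda>i. y i / c) = nrm y / c" if "c > 0" for y c
      using that by (simp add: nrm_def power_divide real_sqrt_divide flip: sum_divide_distrib)
    have nrm_D: "0 < nrm (D x)" if x: "x \<in> ?X" for x
    proof (rule ccontr)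
      assume "\<not> 0 < nrm (D x)"
      then have "(\<Sum>i\<le>m. (D x i)\<^sup>2) = 0" using nrm_nonneg[of "D x"] by (simp add: nrm_def)
      then have D0: "D x i = 0" if "i \<le> m" for i
        using that by (subst (asm) sum_nonneg_eq_0_iff) auto
      have "x u = x (\<rho> u)" if "u \<in> V - \<rho> ` V" for u
        using D0[of "k u"] hk[OF that] by (simp add: D_def)
      then show False using not_const x by blast
    qed
    have D_w: "D (w y) = y" if "\<And>i. i > m \<Longrightarrow> y i = 0" for y
    proof
      fix i
      show "D (w y) i = y i"
      proof (cases "i \<le> m")
        case True
        have hi: "h i \<in> V" "h i \<notin> \<rho> ` V" using hV[OF True] by auto
        have "B (\<rho> (h i)) = B (h i)" using B_const B hi by blast
        then show ?thesis using True hi \<rho>V kh by (simp add: D_def w_def L_def)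
      qed (use that in \<open>simp add: D_def\<close>)
    qed
    have w_nonneg: "0 \<le> w y u" for y u
      using B[of u] finB[of u] by (auto simp: w_def intro!: Min_le)
    have w_zero: "\<exists>u\<in>p. w y u = 0" if "p \<in> P" for p y
    proof -
      have "p \<noteq> {}" using that partition_onD3[OF P] by blast
      then obtain u where u: "u \<in> p" by blast
      have uV: "u \<in> V" "B u = p" using u that B_sub B_eq by blast+
      have "Min (L y ` p) \<in> L y ` p" using uV u finB[of u] by (intro Min_in) auto
      then obtain z where z: "z \<in> p" "L y z = Min (L y ` p)" by (metis imageE)
      then show ?thesis using B_eq that B_sub by (intro bexI[of _ z]) (auto simp: w_def)
    qed
    have tot: "0 < sum (w y) V" if y: "y \<in> T" for y
    proof (rule ccontr)
      assume "\<not> 0 < sum (w y) V"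
      then have "sum (w y) V = 0" using sum_nonneg[of V "w y"] w_nonneg by force
      then have w0: "w y u = 0" if "u \<in> V" for u
        using that fin w_nonneg by (subst (asm) sum_nonneg_eq_0_iff) auto
      have "D (w y) i = 0" for i using w0 hV \<rho>V by (simp add: D_def)
      then have "y i = 0" for i using D_w[of y] y by (simp add: T_def)
      then show False using y by (simp add: T_def)
    qed
    have w_D: "w (\<lambda>i. D x i / c) = (\<lambda>u. x u / c)" if x: "x \<in> ?X" and c: "c > 0" for x c
    proof
      fix u
      show "w (\<lambda>i. D x i / c) u = x u / c"
      proof (cases "u \<in> V")
        case True
        have L: "L (\<lambda>i. D x i / c) z = (x z - x (\<rho> u)) / c" if z: "z \<in> B u" for z
        proof -
          have zV: "z \<in> V" using z True B B_sub by blast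
          have "\<rho> z = \<rho> u" using \<rho>_eq True z by blast
          moreover have "x z = x (\<rho> z)" if "z \<in> \<rho> ` V" using that \<rho>\<rho> by auto
          ultimately show ?thesis using zV hk[of z] by (auto simp: L_def D_def)
        qed
        obtain z0 where z0: "z0 \<in> B u" "x z0 = 0" using zero[OF x True] by blast
        have "Min (L (\<lambda>i. D x i / c) ` B u) = - x (\<rho> u) / c"
        proof (rule Min_eqI)
          show "- x (\<rho> u) / c \<le> a" if "a \<in> L (\<lambda>i. D x i / c) ` B u" for a
            using that L x c by (auto simp: X_iff diff_divide_distrib)
          show "- x (\<rho> u) / c \<in> L (\<lambda>i. D x i / c) ` B u"
            using z0 L by (auto simp: image_iff intro!: bexI[of _ z0])
        qed (use finB True in auto)
        then show ?thesis using True L B by (simp add: w_def diff_divide_distrib)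
      qed (use outside[OF x] in \<open>simp add: w_def\<close>)
    qed
    have F_in: "F x \<in> T" if "x \<in> ?X" for x
    proof -
      have "nrm (F x) = 1" unfolding F_def using nrm_D[OF that] by (simp add: nrm_div)
      then show ?thesis by (auto simp: T_def nrm_def F_def D_def)
    qed
    have G_in: "G y \<in> ?X" if y: "y \<in> T" for y
    proof -
      have "sum (G y) V = 1" using tot[OF y] by (simp add: G_def flip: sum_divide_distrib)
      moreover have "\<exists>u\<in>p. G y u = 0" if "p \<in> P" for p
        using w_zero[OF that, of y] by (auto simp: G_def)
      moreover have "G y u = 0" if "u \<notin> V" for u using that by (simp add: G_def w_def)
      moreover have "0 \<le> G y u" for u using w_nonneg tot[OF y] by (simp add: G_def)
      ultimately show ?thesis by (simp add: X_iff)
    qed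
    have GF: "G (F x) = x" if x: "x \<in> ?X" for x
    proof -
      have "w (F x) = (\<lambda>u. x u / nrm (D x))" unfolding F_def using w_D x nrm_D by blast
      then show ?thesis
        using x nrm_D[OF x] by (simp add: G_def X_iff flip: sum_divide_distrib)
    qed
    have FG: "F (G y) = y" if y: "y \<in> T" for y
    proof -
      have "D (G y) = (\<lambda>i. D (w y) i / sum (w y) V)"
        by (auto simp: G_def D_def diff_divide_distrib)
      then have "D (G y) = (\<lambda>i. y i / sum (w y) V)" using D_w[of y] y by (simp add: T_def)
      moreover have "nrm y = 1" using y by (simp add: nrm_def T_def)
      ultimately show ?thesis using tot[OF y] by (simp add: F_def nrm_div)
    qed
    have cont_D: "continuous_on S (\<lambda>x. D x i)" for S i
      unfolding D_def by (cases "i \<le> m") (auto intro!: continuous_intros continuous_on_coordinate)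
    have cont_F: "continuous_on ?X F"
      unfolding F_def
    proof (intro continuous_on_coordinatewise_then_product continuous_on_divide cont_D ballI)
      show "continuous_on ?X (\<lambda>x. nrm (D x))"
        unfolding nrm_def by (intro continuous_intros cont_D)
      show "nrm (D x) \<noteq> 0" if "x \<in> ?X" for x using nrm_D[OF that] by simp
    qed
    have cont_L: "continuous_on S (\<lambda>y. L y u)" for S u
      unfolding L_def by (cases "u \<in> V - \<rho> ` V") (auto intro!: continuous_on_coordinate)
    have cont_w: "continuous_on S (\<lambda>y. w y u)" for S u
    proof (cases "u \<in> V")
      case True
      then have "continuous_on S (\<lambda>y. L y u - Min ((\<lambda>z. L y z) ` B u))"
        using finB B by (intro continuous_on_diff cont_L continuous_on_Min_image) auto
      then show ?thesis using True by (simp add: w_def)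
    qed (simp add: w_def)
    have cont_G: "continuous_on T G"
      unfolding G_def
    proof (intro continuous_on_coordinatewise_then_product continuous_on_divide cont_w ballI)
      show "continuous_on T (\<lambda>y. sum (w y) V)" by (intro continuous_intros cont_w)
      show "sum (w y) V \<noteq> 0" if "y \<in> T" for y using tot[OF that] by simp
    qed
    have "homeomorphic_maps (top_of_set ?X) (top_of_set T) F G"
      unfolding homeomorphic_maps_def using cont_F cont_G F_in G_in GF FG by auto
    then show ?thesis
      unfolding geometric_realization_eq sphere homeomorphic_space_def by blast
  qed
qed

section \<open>Splitting the dominance complex of a chordal graph\<close>

text \<open>Since \<open>N = N[v]\<close> is a clique, it is contained in \<open>N[x]\<close> for every \<open>x \<in> N\<close>, so among these
  non-faces only \<open>N\<close> matters, and it is the only remaining one that contains \<open>v\<close>. The target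
  complex shrinks every other \<open>N[x]\<close> to \<open>N[x] - N\<close>, the closed neighbourhood of \<open>x\<close> in the graph
  without \<open>N\<close>. A face that is lost contains some \<open>N[x] - N\<close>, and hence not all of \<open>N - {v}\<close>, or it
  would contain \<open>N[x]\<close>, as \<open>v \<notin> N[x]\<close>. Neither property depends on whether \<open>v\<close> belongs to the face, so inserting
  and deleting \<open>v\<close> matches the lost faces.

  The extra non-faces \<open>Q\<close> on a disjoint vertex set \<open>W\<close> form a join factor, which makes the step
  repeatable.\<close>

lemma split_off_simplicial_neighbourhood:
  fixes V W :: "'a set"
  assumes fin: "finite V" "finite W" and VW: "W \<inter> V = {}" and v: "v \<in> V"
    and N: "N = closed_nbhd E V v" "clique E N"
    and Q: "\<Union>Q \<subseteq> W" "{} \<notin> Q"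
  shows "geometric_realization (independence_complex (V \<union> W) (closed_nbhd E V ` V \<union> Q))
    homotopy_equivalent_space
    geometric_realization (independence_complex (V \<union> W) (closed_nbhd E (V - N) ` (V - N) \<union> insert N Q))"
    (is "geometric_realization ?K homotopy_equivalent_space geometric_realization ?K'")
proof (rule homotopy_equivalent_space_matched_subcomplex[of "V \<union> W" _ _ v])
  have vN: "v \<in> N" using v N by (simp add: closed_nbhd_def)
  have NV: "N \<subseteq> V" using N by (auto simp: closed_nbhd_def)
  have N_le: "N \<subseteq> closed_nbhd E V x" if "x \<in> N" for x
    using that N(2) NV by (auto simp: clique_def closed_nbhd_def)
  have v_notin: "v \<notin> closed_nbhd E V x" if "x \<in> V - N" for x
    using that N v by (auto simp: closed_nbhd_def insert_commute)
  have nbhd_diff: "closed_nbhd E (V - N) x = closed_nbhd E V x - N" for x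
    by (auto simp: closed_nbhd_def)
  have K_iff: "\<sigma> \<in> ?K \<longleftrightarrow> \<sigma> \<subseteq> V \<union> W \<and> (\<forall>x\<in>V. \<not> closed_nbhd E V x \<subseteq> \<sigma>) \<and> (\<forall>h\<in>Q. \<not> h \<subseteq> \<sigma>)" for \<sigma>
    by (auto simp: independence_complex_def)
  have K'_iff: "\<sigma> \<in> ?K' \<longleftrightarrow> \<sigma> \<subseteq> V \<union> W \<and> \<not> N \<subseteq> \<sigma> \<and> (\<forall>x\<in>V - N. \<not> closed_nbhd E V x - N \<subseteq> \<sigma>)
      \<and> (\<forall>h\<in>Q. \<not> h \<subseteq> \<sigma>)" for \<sigma>
    by (auto simp: independence_complex_def nbhd_diff)
  show "?K' \<subseteq> ?K"
  proof
    fix \<sigma>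
    assume \<sigma>: "\<sigma> \<in> ?K'"
    have "\<not> closed_nbhd E V x \<subseteq> \<sigma>" if "x \<in> V" for x
      using that \<sigma> N_le[of x] unfolding K'_iff by blast
    then show "\<sigma> \<in> ?K" using \<sigma> unfolding K_iff K'_iff by blast
  qed
  have "x \<in> closed_nbhd E V x - N" if "x \<in> V - N" for x
    using that by (auto simp: closed_nbhd_def)
  then show "{} \<in> ?K'" unfolding K'_iff using Q vN by auto
  show "insert v \<sigma> \<in> ?K \<and> \<sigma> - {v} \<notin> ?K'" if "\<sigma> \<in> ?K - ?K'" for \<sigma>
  proof -
    have \<sigma>: "\<sigma> \<subseteq> V \<union> W" "\<forall>x\<in>V. \<not> closed_nbhd E V x \<subseteq> \<sigma>" "\<forall>h\<in>Q. \<not> h \<subseteq> \<sigma>"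
      using that unfolding Diff_iff K_iff by blast+
    have "\<not> N \<subseteq> \<sigma>" using \<sigma>(2) v N by blast
    have "\<exists>x\<in>V - N. closed_nbhd E V x - N \<subseteq> \<sigma>"
    proof (rule ccontr)
      assume "\<not> ?thesis"
      then have "\<sigma> \<in> ?K'" unfolding K'_iff by (intro conjI \<sigma>(1,3) \<open>\<not> N \<subseteq> \<sigma>\<close>) blast
      then show False using that by (meson DiffD2)
    qed
    then obtain x where x: "x \<in> V - N" "closed_nbhd E V x - N \<subseteq> \<sigma>" by blast
    have "\<not> closed_nbhd E V y \<subseteq> insert v \<sigma>" if y: "y \<in> V" for y
    proof (cases "y \<in> N")
      case True
      have "\<not> closed_nbhd E V x \<subseteq> \<sigma>" using \<sigma>(2) x by blast
      then have "\<not> N \<subseteq> insert v \<sigma>" using x v_notin[OF x(1)] by blast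
      then show ?thesis using N_le[OF True] by blast
    next
      case False
      then show ?thesis using v_notin[of y] y \<sigma>(2) by blast
    qed
    moreover have "\<not> h \<subseteq> insert v \<sigma>" if "h \<in> Q" for h
      using that Q(1) VW v \<sigma>(3) by blast
    ultimately have "insert v \<sigma> \<in> ?K" using \<sigma>(1) v unfolding K_iff by blast
    moreover have "\<sigma> - {v} \<notin> ?K'" using x vN unfolding K'_iff by blast
    ultimately show ?thesis ..
  qed
  show "?K \<subseteq> Pow (V \<union> W)" by (auto simp: independence_complex_def)
  show "finite (V \<union> W)" "v \<in> V \<union> W" using fin v by auto
qed (rule independence_complex_down; assumption)+

text \<open>Splitting off closed neighbourhoods of simplicial vertices until no vertex is left. The
  simplicial vertices used form the independent set \<open>I\<close>, with one vertex in each of the cliques \<open>P\<close>;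
  the statement carries a join factor \<open>(W, Q)\<close> because the neighbourhood \<open>N\<close> that is split off
  becomes part of this factor for the remaining graph.\<close>

lemma chordal_split_into_simplex_boundaries:
  fixes V :: "'a set"
  assumes "finite V" and loopless: "\<And>a. {a} \<notin> E" and "chordal V E"
  shows "\<exists>P I. partition_on V P \<and> (\<forall>p\<in>P. clique E p) \<and>
    I \<subseteq> V \<and> (\<forall>a\<in>I. \<forall>b\<in>I. {a, b} \<notin> E) \<and> card I = card P \<and>
    (\<forall>W Q. finite W \<longrightarrow> W \<inter> V = {} \<longrightarrow> \<Union>Q \<subseteq> W \<longrightarrow> {} \<notin> Q \<longrightarrow>
      geometric_realization (independence_complex (V \<union> W) (closed_nbhd E V ` V \<union> Q))
      homotopy_equivalent_space geometric_realization (independence_complex (V \<union> W) (P \<union> Q)))"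
  using assms(1,3)
proof (induction V rule: finite_psubset_induct)
  case (psubset V)
  show ?case
  proof (cases "V = {}")
    case True
    then show ?thesis
      by (intro exI[of _ "{}"]) (auto simp: partition_on_def homotopy_equivalent_space_refl)
  next
    case False
    obtain v where v: "v \<in> V" "clique E (closed_nbhd E V v)"
      using chordal_simplicial_vertex[OF psubset.hyps loopless psubset.prems False] by blast
    define N where "N = closed_nbhd E V v"
    have vN: "v \<in> N" and NV: "N \<subseteq> V" using v by (auto simp: N_def closed_nbhd_def)
    have "V - N \<subset> V" using vN v by blast
    moreover have "chordal (V - N) E" using chordal_subset psubset.prems by blast
    ultimately obtain P I where P: "partition_on (V - N) P" "\<forall>p\<in>P. clique E p"
      and I: "I \<subseteq> V - N" "\<forall>a\<in>I. \<forall>b\<in>I. {a, b} \<notin> E" "card I = card P"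
      and equiv: "\<And>W Q. finite W \<Longrightarrow> W \<inter> (V - N) = {} \<Longrightarrow> \<Union>Q \<subseteq> W \<Longrightarrow> {} \<notin> Q \<Longrightarrow>
        geometric_realization (independence_complex (V - N \<union> W) (closed_nbhd E (V - N) ` (V - N) \<union> Q))
        homotopy_equivalent_space geometric_realization (independence_complex (V - N \<union> W) (P \<union> Q))"
      using psubset.IH[of "V - N"] by metis
    have part: "partition_on V (insert N P)"
      using P(1) vN NV by (subst partition_on_insert) (auto simp: disjnt_def dest: partition_onD1)
    have "N \<notin> P" using P(1) vN by (auto simp: partition_on_def)
    moreover have "finite P" using P(1) psubset.hyps by (meson finite_Diff finite_elements)
    moreover have "finite I" using I(1) psubset.hyps finite_subset by blast
    moreover have "v \<notin> I" using I(1) vN by blast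
    ultimately have card: "card (insert v I) = card (insert N P)" using I(3) by simp
    have "{a, v} \<notin> E" if "a \<in> I" for a
      using that I(1) by (auto simp: N_def closed_nbhd_def)
    then have indep: "\<forall>a\<in>insert v I. \<forall>b\<in>insert v I. {a, b} \<notin> E"
      using I(2) loopless by (auto simp: insert_commute)
    have "geometric_realization (independence_complex (V \<union> W) (closed_nbhd E V ` V \<union> Q))
      homotopy_equivalent_space geometric_realization (independence_complex (V \<union> W) (insert N P \<union> Q))"
      if W: "finite W" "W \<inter> V = {}" and Q: "\<Union>Q \<subseteq> W" "{} \<notin> Q" for W Q
    proof -
      have VW: "V - N \<union> (W \<union> N) = V \<union> W" using NV by blast
      have "geometric_realization (independence_complex (V \<union> W) (closed_nbhd E V ` V \<union> Q))
        homotopy_equivalent_space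
        geometric_realization (independence_complex (V \<union> W) (closed_nbhd E (V - N) ` (V - N) \<union> insert N Q))"
        using split_off_simplicial_neighbourhood[OF psubset.hyps W v(1) N_def _ Q] v(2) N_def by simp
      moreover have "geometric_realization (independence_complex (V \<union> W) (closed_nbhd E (V - N) ` (V - N) \<union> insert N Q))
        homotopy_equivalent_space geometric_realization (independence_complex (V \<union> W) (P \<union> insert N Q))"
        using equiv[of "W \<union> N" "insert N Q"] W Q vN NV psubset.hyps finite_subset unfolding VW by blast
      ultimately have "geometric_realization (independence_complex (V \<union> W) (closed_nbhd E V ` V \<union> Q))
        homotopy_equivalent_space geometric_realization (independence_complex (V \<union> W) (P \<union> insert N Q))"
        by (rule homotopy_eqv_trans)
      then show ?thesis by simp
    qed
    then show ?thesis
      using part P(2) v(2) I(1) card indep unfolding N_def[symmetric]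
      by (intro exI[of _ "insert N P"] exI[of _ "insert v I"]) (use v(1) in auto)
  qed
qed

text \<open>Complements of vertex covers are the independent sets, and an independent set has at most one
  vertex in each clique of \<open>P\<close>; the set \<open>I\<close> attains this bound.\<close>

lemma vertex_cover_number_eq:
  assumes "finite_graph V E" and P: "partition_on V P" "\<forall>p\<in>P. clique E p"
    and I: "I \<subseteq> V" "\<forall>a\<in>I. \<forall>b\<in>I. {a, b} \<notin> E" "card I = card P"
  shows "vertex_cover_number V E + card P = card V"
proof -
  have fin: "finite V" and E: "\<And>e. e \<in> E \<Longrightarrow> e \<subseteq> V \<and> card e = 2"
    using assms(1) by (auto simp: finite_graph_def)
  have finP: "finite P" using finite_elements fin P by blast
  have cover: "vertex_cover V E (V - I)"
    unfolding vertex_cover_def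
  proof (intro conjI ballI)
    fix e
    assume e: "e \<in> E"
    then obtain a b where ab: "e = {a, b}" using E by (meson card_2_iff)
    then have "a \<notin> I \<or> b \<notin> I" using I(2) e by blast
    then show "\<exists>v\<in>V - I. v \<in> e" using E[OF e] ab by auto
  qed auto
  have card_cover: "card (V - I) + card P = card V"
    using I fin by (metis card_Diff_subset card_mono finite_subset le_add_diff_inverse2)
  have lower: "card V \<le> card C + card P" if C: "vertex_cover V E C" for C
  proof -
    have "\<forall>u\<in>V - C. \<exists>p\<in>P. u \<in> p" using partition_onD1[OF P(1)] by auto
    then obtain f where f: "\<And>u. u \<in> V - C \<Longrightarrow> f u \<in> P \<and> u \<in> f u" by metis
    have "inj_on f (V - C)"
    proof (rule inj_onI, rule ccontr)
      fix a b
      assume ab: "a \<in> V - C" "b \<in> V - C" "f a = f b" "a \<noteq> b"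
      then have "{a, b} \<in> E" using f P(2) unfolding clique_def by metis
      then show False using C ab by (auto simp: vertex_cover_def)
    qed
    then have "card (V - C) \<le> card P" using f finP by (intro card_inj_on_le) auto
    moreover have "card V = card C + card (V - C)"
      using C fin by (metis card_Diff_subset card_mono finite_subset le_add_diff_inverse vertex_cover_def)
    ultimately show ?thesis by simp
  qed
  have "finite {C. vertex_cover V E C}"
    by (rule finite_subset[of _ "Pow V"]) (auto simp: vertex_cover_def fin)
  then have "vertex_cover_number V E = card (V - I)"
    unfolding vertex_cover_number_def
    using cover lower card_cover by (intro Min_eqI) force+
  then show ?thesis using card_cover by simp
qed

lemma dominance_complex_eq_independence_complex:
  "dominance_complex V E = independence_complex V (closed_nbhd E V ` V)"
proof -
  have "dominating_set V E (V - \<sigma>) \<longleftrightarrow> (\<forall>x\<in>V. \<not> closed_nbhd E V x \<subseteq> \<sigma>)" if "\<sigma> \<subseteq> V" for \<sigma>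
  proof
    assume dom: "dominating_set V E (V - \<sigma>)"
    show "\<forall>x\<in>V. \<not> closed_nbhd E V x \<subseteq> \<sigma>"
    proof
      fix x
      assume "x \<in> V"
      then have "x \<in> V - \<sigma> \<or> (\<exists>u\<in>V - \<sigma>. {u, x} \<in> E)"
        using dom unfolding dominating_set_def by blast
      then show "\<not> closed_nbhd E V x \<subseteq> \<sigma>" unfolding closed_nbhd_def by blast
    qed
  next
    assume not_sub: "\<forall>x\<in>V. \<not> closed_nbhd E V x \<subseteq> \<sigma>"
    have "\<exists>u\<in>V - \<sigma>. {u, x} \<in> E" if "x \<in> \<sigma>" for x
    proof -
      obtain u where "u \<in> closed_nbhd E V x" "u \<notin> \<sigma>" using not_sub \<open>\<sigma> \<subseteq> V\<close> \<open>x \<in> \<sigma>\<close> by blast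
      then show ?thesis using \<open>x \<in> \<sigma>\<close> by (auto simp: closed_nbhd_def)
    qed
    then show "dominating_set V E (V - \<sigma>)" by (auto simp: dominating_set_def)
  qed
  then show ?thesis by (auto simp: dominance_complex_def independence_complex_def)
qed

theorem theorem5p4:
  fixes V :: "'a set" and E :: "'a set set"
  assumes "finite_graph V E"
    and "chordal V E"
  shows "geometric_realization (dominance_complex V E)
           homotopy_equivalent_space sphere_of_dim (int (vertex_cover_number V E) - 1)"
proof -
  have fin: "finite V" and loopless: "\<And>a. {a} \<notin> E"
    using assms(1) by (auto simp: finite_graph_def)
  obtain P I where P: "partition_on V P" "\<forall>p\<in>P. clique E p"
    and I: "I \<subseteq> V" "\<forall>a\<in>I. \<forall>b\<in>I. {a, b} \<notin> E" "card I = card P"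
    and equiv: "\<And>W Q. finite W \<Longrightarrow> W \<inter> V = {} \<Longrightarrow> \<Union>Q \<subseteq> W \<Longrightarrow> {} \<notin> Q \<Longrightarrow>
      geometric_realization (independence_complex (V \<union> W) (closed_nbhd E V ` V \<union> Q))
      homotopy_equivalent_space geometric_realization (independence_complex (V \<union> W) (P \<union> Q))"
    using chordal_split_into_simplex_boundaries[OF fin loopless assms(2)] by metis
  have "geometric_realization (dominance_complex V E)
    homotopy_equivalent_space geometric_realization (independence_complex V P)"
    using equiv[of "{}" "{}"] by (simp add: dominance_complex_eq_independence_complex)
  moreover have "geometric_realization (independence_complex V P)
    homotopy_equivalent_space sphere_of_dim (int (card V) - int (card P) - 1)"
    using homeomorphic_join_of_simplex_boundaries[OF fin P(1)]
    by (rule homeomorphic_imp_homotopy_equivalent_space)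
  moreover have "int (card V) - int (card P) = int (vertex_cover_number V E)"
    using vertex_cover_number_eq[OF assms(1) P I] by simp
  ultimately show ?thesis using homotopy_eqv_trans by metis
qed

end
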